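(* For any semistandard Young tableau $T$ (of partition shape, entries in $\{1,\dots,N\}$), $\mathbf u_{\mathrm{colword}(T)}\equiv\mathbf u_{\mathrm{diagread}(T)}\pmod{I_{\mathrm B}}$.
   Context: $\mathcal U=\mathbb Z\langle u_1,\dots,u_N\rangle$; $\mathbf u_{\mathsf w}=u_{\mathsf w_1}\cdots u_{\mathsf w_n}$. $I_{\mathrm B}$ is the two-sided ideal generated by $u_b^2u_a+u_au_bu_a-u_bu_au_b-u_bu_a^2$ ($a<b$), $u_bu_cu_a-u_bu_au_c$ and $u_au_cu_b-u_cu_au_b$ ($a<b<c$). Tableaux are in English convention. $\mathrm{colword}(T)$ concatenates the columns of $T$, each read bottom to top, starting with the leftmost column. $\mathrm{diagread}(T)$ concatenates the diagonals of $T$ (cells $(i,j)$ with fixed $j-i$), each read in the southeast direction, starting with the southwesternmost diagonal. *)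

theory Defs
  imports Main
begin

text \<open>Elements of the free associative ring Z<u_1,...,u_N> are modelled as functions
from words (lists of letter indices) to integer coefficients, with finite support
contained in words over the alphabet {1..N}.\<close>

type_synonym ncpoly = "nat list \<Rightarrow> int"

definition ncpoly_in :: "nat \<Rightarrow> ncpoly \<Rightarrow> bool" where
  "ncpoly_in N p \<longleftrightarrow> finite {w. p w \<noteq> 0} \<and> (\<forall>w. p w \<noteq> 0 \<longrightarrow> set w \<subseteq> {1..N})"

definition mon :: "nat list \<Rightarrow> ncpoly" where
  "mon w = (\<lambda>v. if v = w then 1 else 0)"

definition ncadd :: "ncpoly \<Rightarrow> ncpoly \<Rightarrow> ncpoly" where
  "ncadd p q = (\<lambda>w. p w + q w)"

definition ncsub :: "ncpoly \<Rightarrow> ncpoly \<Rightarrow> ncpoly" where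
  "ncsub p q = (\<lambda>w. p w - q w)"

definition ncmul :: "ncpoly \<Rightarrow> ncpoly \<Rightarrow> ncpoly" where
  "ncmul p q = (\<lambda>w. \<Sum>i\<le>length w. p (take i w) * q (drop i w))"

definition IB_gens :: "nat \<Rightarrow> ncpoly set" where
  "IB_gens N =
     {ncsub (ncsub (ncadd (mon [b,b,a]) (mon [a,b,a])) (mon [b,a,b])) (mon [b,a,a])
        | a b. 1 \<le> a \<and> a < b \<and> b \<le> N}
   \<union> {ncsub (mon [b,c,a]) (mon [b,a,c]) | a b c. 1 \<le> a \<and> a < b \<and> b < c \<and> c \<le> N}
   \<union> {ncsub (mon [a,c,b]) (mon [c,a,b]) | a b c. 1 \<le> a \<and> a < b \<and> b < c \<and> c \<le> N}"

inductive_set IB :: "nat \<Rightarrow> ncpoly set" for N :: nat where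
  gen: "g \<in> IB_gens N \<Longrightarrow> g \<in> IB N"
| zero: "(\<lambda>_. 0) \<in> IB N"
| add: "p \<in> IB N \<Longrightarrow> q \<in> IB N \<Longrightarrow> ncadd p q \<in> IB N"
| sub: "p \<in> IB N \<Longrightarrow> q \<in> IB N \<Longrightarrow> ncsub p q \<in> IB N"
| lmul: "ncpoly_in N a \<Longrightarrow> p \<in> IB N \<Longrightarrow> ncmul a p \<in> IB N"
| rmul: "ncpoly_in N a \<Longrightarrow> p \<in> IB N \<Longrightarrow> ncmul p a \<in> IB N"

text \<open>Tableaux: list of rows (top row first), English convention; T!i!j is cell (i,j), 0-indexed.\<close>
definition is_SSYT :: "nat \<Rightarrow> nat list list \<Rightarrow> bool" where
  "is_SSYT N T \<longleftrightarrow>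
     (\<forall>r\<in>set T. r \<noteq> []) \<and>
     (\<forall>i. Suc i < length T \<longrightarrow> length (T ! Suc i) \<le> length (T ! i)) \<and>
     (\<forall>r\<in>set T. sorted r) \<and>
     (\<forall>i j. Suc i < length T \<and> j < length (T ! Suc i) \<longrightarrow> T ! i ! j < T ! Suc i ! j) \<and>
     (\<forall>r\<in>set T. set r \<subseteq> {1..N})"

definition num_cols :: "nat list list \<Rightarrow> nat" where
  "num_cols T = (if T = [] then 0 else length (hd T))"

definition colword :: "nat list list \<Rightarrow> nat list" where
  "colword T = concat (map (\<lambda>j. rev [T ! i ! j. i \<leftarrow> [0..<length T], j < length (T ! i)])
                           [0..<num_cols T])"

text \<open>Diagonals j - i = d, from southwesternmost (d = 1 - rows) to d = cols - 1,
  each read southeast (increasing row index).\<close>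
definition diagread :: "nat list list \<Rightarrow> nat list" where
  "diagread T = concat (map (\<lambda>d. [T ! i ! nat (int i + d).
        i \<leftarrow> [0..<length T], 0 \<le> int i + d \<and> nat (int i + d) < length (T ! i)])
     [1 - int (length T)..int (num_cols T) - 1])"

end

theory Submission
  imports Defs
begin

text \<open>For \<open>k \<le> n\<close> (the number of columns) consider the word that reads, southwest to
northeast, the diagonals of the first \<open>k\<close> columns (each southeast), followed by the
columns \<open>k, \<dots>, n - 1\<close> (each bottom to top). For \<open>k = 0\<close> this is the column word and for
\<open>k = n\<close> the diagonal reading. Passing from \<open>k\<close> to \<open>k + 1\<close> appends each cell of column \<open>k\<close>
to its diagonal. Column \<open>k\<close> read upwards decreases, the diagonal pieces increase, and
the tableau inequalities place everything so that this redistribution is a sequence of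
moves \<open>a c b \<rightarrow> c a b\<close> with \<open>a < b < c\<close>, one family of generators of \<open>I_B\<close>.\<close>

definition IB_equiv :: "nat \<Rightarrow> nat list \<Rightarrow> nat list \<Rightarrow> bool" where
  "IB_equiv N x y \<longleftrightarrow> ncsub (mon x) (mon y) \<in> IB N"

lemma ncmul_mon_left:
  "ncmul (mon u) q =
     (\<lambda>w. if length u \<le> length w \<and> take (length u) w = u then q (drop (length u) w) else 0)"
proof
  fix w
  have "(\<Sum>i\<le>length w. mon u (take i w) * q (drop i w)) =
        (\<Sum>i\<le>length w. if i = length u
           then (if take (length u) w = u then q (drop (length u) w) else 0) else 0)"
    by (rule sum.cong) (auto simp: mon_def)
  then show "ncmul (mon u) q w =
      (if length u \<le> length w \<and> take (length u) w = u then q (drop (length u) w) else 0)"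
    by (simp add: ncmul_def)
qed

lemma ncmul_mon_right:
  "ncmul p (mon v) =
     (\<lambda>w. if length v \<le> length w \<and> drop (length w - length v) w = v
          then p (take (length w - length v) w) else 0)"
proof
  fix w
  have "(\<Sum>i\<le>length w. p (take i w) * mon v (drop i w)) =
        (\<Sum>i\<le>length w. if i = length w - length v
           then (if length v \<le> length w \<and> drop (length w - length v) w = v
                 then p (take (length w - length v) w) else 0) else 0)"
    by (rule sum.cong) (auto simp: mon_def)
  then show "ncmul p (mon v) w =
      (if length v \<le> length w \<and> drop (length w - length v) w = v
       then p (take (length w - length v) w) else 0)"
    by (simp add: ncmul_def)
qed

lemma prefix_suffix_decomp:
  assumes "length u \<le> length w" "take (length u) w = u" "length v \<le> length w - length u"
    "drop (length w - length v) w = v"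
  shows "w = u @ take (length w - (length u + length v)) (drop (length u) w) @ v"
proof -
  let ?k = "length w - (length u + length v)"
  have "drop ?k (drop (length u) w) = v"
    using assms(1,3,4) by (simp add: add.commute)
  then have "drop (length u) w = take ?k (drop (length u) w) @ v"
    by (metis append_take_drop_id)
  then show ?thesis using assms(2) by (metis append_take_drop_id)
qed

lemma ncmul_mon_ncsub_mon:
  "ncmul (mon u) (ncmul (ncsub (mon x) (mon y)) (mon v)) = ncsub (mon (u @ x @ v)) (mon (u @ y @ v))"
proof
  fix w
  show "ncmul (mon u) (ncmul (ncsub (mon x) (mon y)) (mon v)) w = ncsub (mon (u @ x @ v)) (mon (u @ y @ v)) w"
    unfolding ncmul_mon_left ncmul_mon_right
    by (simp add: ncsub_def mon_def) (auto simp: append_eq_conv_conj dest: prefix_suffix_decomp)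
qed

lemma ncpoly_in_mon: "set u \<subseteq> {1..N} \<Longrightarrow> ncpoly_in N (mon u)"
  by (auto simp: ncpoly_in_def mon_def)

lemma IB_equiv_refl: "IB_equiv N x x"
proof -
  have "ncsub (mon x) (mon x) = (\<lambda>_. 0)" by (auto simp: ncsub_def)
  then show ?thesis unfolding IB_equiv_def using IB.zero by simp
qed

lemma IB_equiv_trans: "IB_equiv N x y \<Longrightarrow> IB_equiv N y z \<Longrightarrow> IB_equiv N x z"
proof -
  assume "IB_equiv N x y" "IB_equiv N y z"
  then have "ncadd (ncsub (mon x) (mon y)) (ncsub (mon y) (mon z)) \<in> IB N"
    unfolding IB_equiv_def by (rule IB.add)
  moreover have "ncadd (ncsub (mon x) (mon y)) (ncsub (mon y) (mon z)) = ncsub (mon x) (mon z)"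
    by (auto simp: ncsub_def ncadd_def)
  ultimately show ?thesis unfolding IB_equiv_def by simp
qed

lemma IB_equiv_append_context:
  assumes "IB_equiv N x y" "set u \<subseteq> {1..N}" "set v \<subseteq> {1..N}"
  shows "IB_equiv N (u @ x @ v) (u @ y @ v)"
  using IB.lmul[OF ncpoly_in_mon[OF assms(2)]
      IB.rmul[OF ncpoly_in_mon[OF assms(3)] assms(1)[unfolded IB_equiv_def]]]
  unfolding IB_equiv_def ncmul_mon_ncsub_mon .

lemma IB_equiv_acb_cab:
  assumes "1 \<le> a" "a < b" "b < c" "c \<le> N"
  shows "IB_equiv N [a, c, b] [c, a, b]"
  unfolding IB_equiv_def by (rule IB.gen) (use assms in \<open>auto simp: IB_gens_def\<close>)

lemma IB_equiv_move_past_decreasing: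
  assumes "sorted_wrt (>) (C @ [b])" "a < b" "1 \<le> a" "set C \<subseteq> {1..N}" "b \<le> N"
    "set R \<subseteq> {1..N}"
  shows "IB_equiv N (a # C @ b # R) (C @ a # b # R)"
  using assms
proof (induction C)
  case Nil
  then show ?case by (simp add: IB_equiv_refl)
next
  case (Cons c C)
  obtain x rest where x: "C @ b # R = x # rest" "x \<in> set (C @ [b])"
    by (cases C) auto
  have "x < c" using Cons.prems(1) x(2) by auto
  moreover have "a < x" using Cons.prems(1,2) x(2) by (auto simp: sorted_wrt_append)
  moreover have "set (x # rest) \<subseteq> {1..N}" unfolding x(1)[symmetric] using Cons.prems by auto
  ultimately have "IB_equiv N ([] @ [a, c, x] @ rest) ([] @ [c, a, x] @ rest)"
    using Cons.prems by (intro IB_equiv_append_context IB_equiv_acb_cab) auto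
  moreover have "IB_equiv N ([c] @ (a # C @ b # R) @ []) ([c] @ (C @ a # b # R) @ [])"
    using Cons.prems by (intro IB_equiv_append_context Cons.IH) (auto simp: sorted_wrt_append)
  ultimately show ?case using x(1) by (auto intro: IB_equiv_trans)
qed

text \<open>The letter \<open>hd R\<close> plays the role of \<open>b\<close> in the moves \<open>z c b \<rightarrow> c z b\<close>.\<close>

lemma IB_equiv_swap_blocks:
  assumes "sorted_wrt (>) C" "sorted_wrt (<) Z" "\<forall>z\<in>set Z. \<forall>c\<in>set C. z < c"
    "Z \<noteq> [] \<Longrightarrow> C \<noteq> [] \<Longrightarrow> R \<noteq> [] \<and> (\<forall>z\<in>set Z. z < hd R) \<and> (\<forall>c\<in>set C. hd R < c)"
    "set Z \<subseteq> {1..N}" "set C \<subseteq> {1..N}" "set R \<subseteq> {1..N}"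
  shows "IB_equiv N (Z @ C @ R) (C @ Z @ R)"
proof (cases "C = []")
  case True
  then show ?thesis by (simp add: IB_equiv_refl)
next
  case False
  show ?thesis using assms
  proof (induction Z)
    case Nil
    then show ?case by (simp add: IB_equiv_refl)
  next
    case (Cons z Z)
    obtain b rest where b: "Z @ R = b # rest"
      using Cons.prems(4) \<open>C \<noteq> []\<close> by (cases "Z @ R") auto
    have "z < b \<and> (\<forall>c\<in>set C. b < c)"
      using Cons.prems(2-4) \<open>C \<noteq> []\<close> b by (cases Z) auto
    moreover have "set (b # rest) \<subseteq> {1..N}"
      unfolding b[symmetric] using Cons.prems(5,7) by auto
    ultimately have "IB_equiv N (z # C @ b # rest) (C @ z # b # rest)"
      using Cons.prems(1,5,6)
      by (intro IB_equiv_move_past_decreasing) (auto simp: sorted_wrt_append)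
    moreover have "IB_equiv N ([z] @ (Z @ C @ R) @ []) ([z] @ (C @ Z @ R) @ [])"
      using Cons.prems by (intro IB_equiv_append_context Cons.IH) auto
    ultimately show ?case using b by (auto intro: IB_equiv_trans)
  qed
qed

text \<open>In the application a block \<open>(A, e)\<close> is a piece of a diagonal together with the
following cell of that diagonal in the next column, if any.\<close>

definition block_order :: "nat list \<times> nat list \<Rightarrow> nat list \<times> nat list \<Rightarrow> bool" where
  "block_order x y \<longleftrightarrow> (\<forall>z\<in>set (fst y). \<forall>c\<in>set (snd x). z < c) \<and>
     (fst y \<noteq> [] \<longrightarrow> snd x \<noteq> [] \<longrightarrow> snd y \<noteq> [] \<and> (\<forall>z\<in>set (fst y). z < hd (snd y)))"

lemma IB_equiv_merge_blocks:
  assumes "sorted_wrt (>) (concat (map snd L))" "\<forall>x\<in>set L. sorted_wrt (<) (fst x)"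
    "sorted_wrt block_order L" "\<forall>x\<in>set L. set (fst x) \<subseteq> {1..N} \<and> set (snd x) \<subseteq> {1..N}"
    "set R \<subseteq> {1..N}"
  shows "IB_equiv N (concat (map fst L) @ concat (map snd L) @ R)
           (concat (map (\<lambda>x. fst x @ snd x) L) @ R)"
  using assms
proof (induction L arbitrary: R rule: rev_induct)
  case Nil
  then show ?case by (simp add: IB_equiv_refl)
next
  case (snoc x L)
  obtain A e where x: "x = (A, e)" by (cases x)
  let ?A = "concat (map fst L)" and ?E = "concat (map snd L)"
  have E_e: "sorted_wrt (>) (?E @ e)" using snoc.prems(1) x by simp
  have order: "\<forall>y\<in>set L. block_order y (A, e)"
    using snoc.prems(3) x by (simp add: sorted_wrt_append)
  have letters: "set ?E \<subseteq> {1..N}" "set ?A \<subseteq> {1..N}" "set A \<subseteq> {1..N}" "set e \<subseteq> {1..N}"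
    using snoc.prems(4) x by auto
  have "IB_equiv N (A @ ?E @ (e @ R)) (?E @ A @ (e @ R))"
  proof (rule IB_equiv_swap_blocks)
    show "e @ R \<noteq> [] \<and> (\<forall>z\<in>set A. z < hd (e @ R)) \<and> (\<forall>c\<in>set ?E. hd (e @ R) < c)"
      if "A \<noteq> []" "?E \<noteq> []"
    proof -
      obtain y where "y \<in> set L" "snd y \<noteq> []" using \<open>?E \<noteq> []\<close> by auto
      then have "e \<noteq> [] \<and> (\<forall>z\<in>set A. z < hd e)"
        using order \<open>A \<noteq> []\<close> by (auto simp: block_order_def)
      moreover have "\<forall>c\<in>set ?E. hd e < c" if "e \<noteq> []"
        using E_e that by (auto simp: sorted_wrt_append)
      ultimately show ?thesis by auto
    qed
  qed (use E_e order letters snoc.prems(2,5) x in \<open>auto simp: block_order_def sorted_wrt_append\<close>)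
  then have "IB_equiv N (?A @ (A @ ?E @ e @ R) @ []) (?A @ (?E @ A @ e @ R) @ [])"
    using letters by (intro IB_equiv_append_context) auto
  moreover have "IB_equiv N (?A @ ?E @ (A @ e @ R)) (concat (map (\<lambda>x. fst x @ snd x) L) @ (A @ e @ R))"
    using snoc.prems letters by (intro snoc.IH) (auto simp: sorted_wrt_append)
  ultimately show ?case using x by (auto intro: IB_equiv_trans)
qed

lemma set_list_compr: "set [f i. i \<leftarrow> xs, P i] = f ` {i \<in> set xs. P i}"
  by (induction xs) auto

lemma rev_list_compr: "rev [f i. i \<leftarrow> xs, P i] = [f i. i \<leftarrow> rev xs, P i]"
  by (induction xs) auto

lemma sorted_wrt_list_compr_upt:
  assumes "\<And>i j. i < j \<Longrightarrow> j < M \<Longrightarrow> P i \<Longrightarrow> P j \<Longrightarrow> R (f i) (f j)"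
  shows "sorted_wrt R [f i. i \<leftarrow> [0..<M], P i]"
  using assms
proof (induction M)
  case 0
  then show ?case by simp
next
  case (Suc M)
  have "sorted_wrt R [f i. i \<leftarrow> [0..<M], P i]" by (rule Suc.IH) (use Suc.prems in auto)
  moreover have "\<forall>x\<in>set [f i. i \<leftarrow> [0..<M], P i]. \<forall>y\<in>set (if P M then [f M] else []). R x y"
    unfolding set_list_compr using Suc.prems by auto
  ultimately show ?case by (simp add: sorted_wrt_append)
qed

lemma map_minus_rev_upt: "map (\<lambda>i. k - int i) (rev [0..<m]) = [k - int m + 1..k]"
proof (induction m)
  case 0
  then show ?case by simp
next
  case (Suc m)
  have "[k - int (Suc m) + 1..k] = (k - int m) # [k - int m + 1..k]"
    by (subst upto_rec1) auto
  then show ?case using Suc by simp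
qed

lemma list_compr_diagonal_Suc:
  "[f i. i \<leftarrow> [0..<M], 0 \<le> int i + d \<and> nat (int i + d) < min (Suc k) (len i)] =
   [f i. i \<leftarrow> [0..<M], 0 \<le> int i + d \<and> nat (int i + d) < min k (len i)] @
   (if 0 \<le> int k - d \<and> nat (int k - d) < M \<and> k < len (nat (int k - d))
    then [f (nat (int k - d))] else [])"
proof (induction M)
  case 0
  then show ?case by simp
next
  case (Suc M)
  show ?case
  proof (cases "int M + d = int k")
    case True
    then have "nat (int k - d) = M" by simp
    then show ?thesis using Suc.IH True by auto
  qed (use Suc.IH in auto)
qed

text \<open>Cell \<open>(i, j)\<close> lies on diagonal \<open>d = j - i\<close>; \<open>diag_prefix T k d\<close> is the part of that
diagonal in the first \<open>k\<close> columns and \<open>diag_cell T k d\<close> its cell in column \<open>k\<close>, if any.\<close>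

definition diag_prefix :: "nat list list \<Rightarrow> nat \<Rightarrow> int \<Rightarrow> nat list" where
  "diag_prefix T k d = [T ! i ! nat (int i + d). i \<leftarrow> [0..<length T],
      0 \<le> int i + d \<and> nat (int i + d) < min k (length (T ! i))]"

definition diag_cell :: "nat list list \<Rightarrow> nat \<Rightarrow> int \<Rightarrow> nat list" where
  "diag_cell T k d =
     (if 0 \<le> int k - d \<and> nat (int k - d) < length T \<and> k < length (T ! nat (int k - d))
      then [T ! nat (int k - d) ! k] else [])"

definition column :: "nat list list \<Rightarrow> nat \<Rightarrow> nat list" where
  "column T j = [T ! i ! j. i \<leftarrow> [0..<length T], j < length (T ! i)]"

definition diag_range :: "nat list list \<Rightarrow> int list" where
  "diag_range T = [1 - int (length T)..int (num_cols T) - 1]"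

definition mixed_reading :: "nat list list \<Rightarrow> nat \<Rightarrow> nat list" where
  "mixed_reading T k = concat (map (diag_prefix T k) (diag_range T)) @
     concat (map (\<lambda>j. rev (column T j)) [k..<num_cols T])"

lemma diag_prefix_Suc: "diag_prefix T (Suc k) d = diag_prefix T k d @ diag_cell T k d"
proof -
  have "0 \<le> int k - d \<Longrightarrow> nat (int (nat (int k - d)) + d) = k" by simp
  then show ?thesis unfolding diag_prefix_def diag_cell_def list_compr_diagonal_Suc by auto
qed

lemma mixed_reading_0: "mixed_reading T 0 = colword T"
  by (simp add: mixed_reading_def diag_prefix_def colword_def column_def)

lemma rev_column_eq_diag_cells:
  assumes "k < num_cols T"
  shows "rev (column T k) = concat (map (diag_cell T k) (diag_range T))"
proof -
  let ?m = "length T" and ?n = "num_cols T"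
  have "T \<noteq> []" using assms by (auto simp: num_cols_def)
  then have "?m \<ge> 1" by (cases T) auto
  have split: "diag_range T = [1 - int ?m..int k - int ?m] @ [int k - int ?m + 1..int k] @
      [int k + 1..int ?n - 1]"
  proof -
    have "diag_range T = [1 - int ?m..(int k - int ?m + 1) - 1] @ [int k - int ?m + 1..int ?n - 1]"
      unfolding diag_range_def by (rule upto_split1) (use assms \<open>?m \<ge> 1\<close> in auto)
    also have "[int k - int ?m + 1..int ?n - 1] = [int k - int ?m + 1..int k] @ [int k + 1..int ?n - 1]"
      by (rule upto_split2) (use assms \<open>?m \<ge> 1\<close> in auto)
    finally show ?thesis by simp
  qed
  have "concat (map (diag_cell T k) [int k - int ?m + 1..int k]) =
        concat (map (diag_cell T k) (map (\<lambda>i. int k - int i) (rev [0..<?m])))"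
    by (simp add: map_minus_rev_upt)
  also have "\<dots> = [T ! i ! k. i \<leftarrow> rev [0..<?m], k < length (T ! i)]"
    by (auto simp: diag_cell_def intro!: arg_cong[where f=concat] map_cong)
  also have "\<dots> = rev (column T k)" by (simp add: column_def rev_list_compr)
  finally have middle: "concat (map (diag_cell T k) [int k - int ?m + 1..int k]) = rev (column T k)" .
  have left: "concat (map (diag_cell T k) [1 - int ?m..int k - int ?m]) = []"
    and right: "concat (map (diag_cell T k) [int k + 1..int ?n - 1]) = []"
    by (auto simp: diag_cell_def)
  show ?thesis unfolding split map_append concat_append left middle right by simp
qed

context
  fixes N :: nat and T :: "nat list list"
  assumes ssyt: "is_SSYT N T"
begin

lemma row_length_antimono: "i \<le> i' \<Longrightarrow> i' < length T \<Longrightarrow> length (T ! i') \<le> length (T ! i)"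
proof (induction i')
  case (Suc i')
  show ?case
  proof (cases "i = Suc i'")
    case False
    then have "length (T ! i') \<le> length (T ! i)" using Suc by auto
    moreover have "length (T ! Suc i') \<le> length (T ! i')"
      using ssyt Suc.prems by (auto simp: is_SSYT_def)
    ultimately show ?thesis by simp
  qed simp
qed simp

lemma column_strict: "i < i' \<Longrightarrow> i' < length T \<Longrightarrow> j < length (T ! i') \<Longrightarrow> T ! i ! j < T ! i' ! j"
proof (induction i')
  case (Suc i')
  have step: "T ! i' ! j < T ! Suc i' ! j" using ssyt Suc.prems by (auto simp: is_SSYT_def)
  show ?case
  proof (cases "i = i'")
    case False
    have "j < length (T ! i')" using row_length_antimono[of i' "Suc i'"] Suc.prems by simp
    then have "T ! i ! j < T ! i' ! j" using Suc False by auto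
    then show ?thesis using step by simp
  qed (use step in simp)
qed simp

lemma strict_southeast:
  assumes "i < i'" "i' < length T" "j \<le> j'" "j' < length (T ! i')"
  shows "T ! i ! j < T ! i' ! j'"
proof -
  have "j' < length (T ! i)" using row_length_antimono[of i i'] assms by simp
  moreover have "sorted (T ! i)" using ssyt assms by (auto simp: is_SSYT_def)
  ultimately have "T ! i ! j \<le> T ! i ! j'" using assms(3) by (simp add: sorted_nth_mono)
  also have "\<dots> < T ! i' ! j'" using column_strict assms by simp
  finally show ?thesis .
qed

lemma entry_bounds: "i < length T \<Longrightarrow> j < length (T ! i) \<Longrightarrow> T ! i ! j \<in> {1..N}"
  using ssyt unfolding is_SSYT_def by (meson nth_mem subsetD)

lemma row_length_le_num_cols: "i < length T \<Longrightarrow> length (T ! i) \<le> num_cols T"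
  using row_length_antimono[of 0 i] by (cases T) (auto simp: num_cols_def)

lemma mem_diag_prefix:
  "z \<in> set (diag_prefix T k d) \<longleftrightarrow> (\<exists>i. i < length T \<and> 0 \<le> int i + d \<and> nat (int i + d) < k \<and>
      nat (int i + d) < length (T ! i) \<and> z = T ! i ! nat (int i + d))"
  unfolding diag_prefix_def set_list_compr by auto

lemma diag_prefix_sorted: "sorted_wrt (<) (diag_prefix T k d)"
  unfolding diag_prefix_def by (rule sorted_wrt_list_compr_upt) (auto intro!: strict_southeast)

lemma column_sorted: "sorted_wrt (<) (column T j)"
  unfolding column_def by (rule sorted_wrt_list_compr_upt) (auto intro!: column_strict)

lemma block_order_diagonals:
  assumes "d < d'"
  shows "block_order (diag_prefix T k d, diag_cell T k d) (diag_prefix T k d', diag_cell T k d')"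
  unfolding block_order_def fst_conv snd_conv
proof (intro conjI impI ballI)
  fix z c
  assume "z \<in> set (diag_prefix T k d')" and c: "c \<in> set (diag_cell T k d)"
  then obtain i where i: "i < length T" "0 \<le> int i + d'" "nat (int i + d') < k"
    "nat (int i + d') < length (T ! i)" "z = T ! i ! nat (int i + d')"
    by (auto simp: mem_diag_prefix)
  have "0 \<le> int k - d" "nat (int k - d) < length T" "k < length (T ! nat (int k - d))"
    "c = T ! nat (int k - d) ! k" using c by (auto simp: diag_cell_def split: if_splits)
  moreover have "i < nat (int k - d)" using i(2,3) assms by linarith
  ultimately show "z < c" using strict_southeast[of i "nat (int k - d)" "nat (int i + d')" k] i by simp
next
  assume "diag_prefix T k d' \<noteq> []" and "diag_cell T k d \<noteq> []"
  then have "hd (diag_prefix T k d') \<in> set (diag_prefix T k d')" by simp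
  then obtain i where "i < length T" "0 \<le> int i + d'" "nat (int i + d') < k"
    by (auto simp: mem_diag_prefix)
  moreover have r: "0 \<le> int k - d" "nat (int k - d) < length T" "k < length (T ! nat (int k - d))"
    using \<open>diag_cell T k d \<noteq> []\<close> by (auto simp: diag_cell_def split: if_splits)
  moreover have "nat (int k - d') \<le> nat (int k - d)" using assms by linarith
  ultimately have r': "0 \<le> int k - d'" "nat (int k - d') < length T" "k < length (T ! nat (int k - d'))"
    using row_length_antimono[of "nat (int k - d')" "nat (int k - d)"] by linarith+
  then have cell: "diag_cell T k d' = [T ! nat (int k - d') ! k]" by (simp add: diag_cell_def)
  then show "diag_cell T k d' \<noteq> []" by simp
  fix z assume "z \<in> set (diag_prefix T k d')"
  then obtain i' where "i' < length T" "0 \<le> int i' + d'" "nat (int i' + d') < k"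
    "z = T ! i' ! nat (int i' + d')" by (auto simp: mem_diag_prefix)
  moreover have "i' < nat (int k - d')" using calculation by linarith
  ultimately show "z < hd (diag_cell T k d')"
    unfolding cell using strict_southeast[of i' "nat (int k - d')" "nat (int i' + d')" k] r' by simp
qed

lemma mixed_reading_num_cols: "mixed_reading T (num_cols T) = diagread T"
proof -
  have "diag_prefix T (num_cols T) = (\<lambda>d. [T ! i ! nat (int i + d). i \<leftarrow> [0..<length T],
      0 \<le> int i + d \<and> nat (int i + d) < length (T ! i)])"
    unfolding diag_prefix_def using row_length_le_num_cols order_less_le_trans
    by (fastforce intro!: ext arg_cong[where f=concat] map_cong simp: min_absorb2)
  then show ?thesis by (simp add: mixed_reading_def diagread_def diag_range_def)
qed

lemma mixed_reading_Suc:
  assumes "k < num_cols T"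
  shows "IB_equiv N (mixed_reading T k) (mixed_reading T (Suc k))"
proof -
  define L where "L = map (\<lambda>d. (diag_prefix T k d, diag_cell T k d)) (diag_range T)"
  define R where "R = concat (map (\<lambda>j. rev (column T j)) [Suc k..<num_cols T])"
  have cells: "concat (map snd L) = rev (column T k)"
    unfolding L_def using rev_column_eq_diag_cells[OF assms] by (simp add: comp_def)
  have "IB_equiv N (concat (map fst L) @ concat (map snd L) @ R)
      (concat (map (\<lambda>x. fst x @ snd x) L) @ R)"
  proof (rule IB_equiv_merge_blocks)
    show "sorted_wrt (>) (concat (map snd L))"
      unfolding cells using column_sorted by (simp add: sorted_wrt_rev)
    show "sorted_wrt block_order L" unfolding L_def sorted_wrt_map
      by (rule sorted_wrt_mono_rel[OF _ sorted_wrt_upto[of "1 - int (length T)" "int (num_cols T) - 1", folded diag_range_def]])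
        (use block_order_diagonals in auto)
    show "\<forall>x\<in>set L. set (fst x) \<subseteq> {1..N} \<and> set (snd x) \<subseteq> {1..N}"
      unfolding L_def using entry_bounds by (auto simp: mem_diag_prefix diag_cell_def)
    show "set R \<subseteq> {1..N}" unfolding R_def using entry_bounds by (auto simp: column_def set_list_compr)
  qed (auto simp: L_def diag_prefix_sorted)
  moreover have "concat (map fst L) @ concat (map snd L) @ R = mixed_reading T k"
    unfolding cells by (simp add: mixed_reading_def L_def R_def assms upt_conv_Cons comp_def)
  moreover have "concat (map (\<lambda>x. fst x @ snd x) L) @ R = mixed_reading T (Suc k)"
  proof -
    have "diag_prefix T (Suc k) = (\<lambda>d. diag_prefix T k d @ diag_cell T k d)"
      by (rule ext) (rule diag_prefix_Suc)
    then show ?thesis by (simp add: mixed_reading_def L_def R_def comp_def)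
  qed
  ultimately show ?thesis by simp
qed

lemma IB_equiv_mixed_readings: "k \<le> num_cols T \<Longrightarrow> IB_equiv N (mixed_reading T 0) (mixed_reading T k)"
proof (induction k)
  case 0
  then show ?case by (simp add: IB_equiv_refl)
next
  case (Suc k)
  then show ?case using mixed_reading_Suc[of k] IB_equiv_trans by auto
qed

end

theorem proposition9p10:
  fixes N :: nat and T :: "nat list list"
  assumes "is_SSYT N T"
  shows "ncsub (mon (colword T)) (mon (diagread T)) \<in> IB N"
  using IB_equiv_mixed_readings[OF assms order_refl]
  unfolding mixed_reading_0 mixed_reading_num_cols[OF assms] IB_equiv_def .

end
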